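(* Let $f_1,\dots,f_N:\mathbb R^n\to\mathbb R$ be such that $\sum_{i=1}^N f_i(x_i)$ is $\omega_f$-smooth and convex. Let $z^*$ be an optimal solution of $\min_{x_1,\dots,x_N,z}\sum_{i=1}^N f_i(x_i)$ s.t. $x_i=z$ for all $i$, with optimal dual variables $\lambda^*=(\lambda_1^*,\dots,\lambda_N^* )$, let $g_i^*=\nabla f_i(z^* )=-\lambda_i^*$, and let $$\mathscr L(z,\lambda)=\frac1\rho\sum_{i=1}^N\|\lambda_i-\lambda_i^*\|^2+\rho N\|z-z^*\|^2 .$$ Suppose there exists $\delta>0$ such that, for the iterations $(z,\lambda)\mapsto(z^+,\lambda^+)$ of Reduced Consensus ALADIN, $$\delta\,\mathscr L(z^+,\lambda^+)\le \frac{4}{\omega_f}\sum_{i=1}^N\|g_i-g_i^*\|^2 .$$ Then Reduced Consensus ALADIN converges Q-linearly to a unique optimal solution with rate $\frac{1}{\sqrt{1+\delta}}$.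
   Context: $\|\cdot\|$ is the Euclidean norm and $\rho>0$ is a fixed parameter. One iteration of Reduced Consensus ALADIN maps $(z,\lambda)$, with $z\in\mathbb R^n$, $\lambda=(\lambda_1,\dots,\lambda_N)\in(\mathbb R^n)^N$ and $\sum_{i=1}^N\lambda_i=0$, to $(z^+,\lambda^+)$ by $$x_i^+=\arg\min_{x_i} f_i(x_i)+\lambda_i^\top x_i+\tfrac{\rho}{2}\|x_i-z\|^2,\qquad g_i=\rho(z-x_i^+)-\lambda_i,$$ $$z^+=\frac1N\sum_{i=1}^N\Big(x_i^+-\frac{g_i}{\rho}\Big),\qquad \lambda_i^+=\rho(x_i^+-z^+)-g_i .$$ Here $g_i$ is the (sub)gradient of $f_i$ at $x_i^+$. The optimal dual variables $\lambda_i^*$ are the multipliers of the constraints $x_i=z$; they satisfy $\nabla f_i(z^* )+\lambda_i^*=0$ for all $i$ and $\sum_{i=1}^N\lambda_i^*=0$. A function is $\omega_f$-smooth ($\omega_f>0$) if it is differentiable with $\omega_f$-Lipschitz continuous gradient; in particular $\|g_i-g_i^*\|\le\omega_f\|x_i^+-z^*\|$. *)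

theory Defs
  imports "HOL-Analysis.Analysis"
begin

definition smooth_fun :: "real \<Rightarrow> ('a::real_inner \<Rightarrow> real) \<Rightarrow> bool" where
  "smooth_fun \<omega> F \<longleftrightarrow>
     (\<exists>G. (\<forall>x. GDERIV F x :> G x) \<and> \<omega>-lipschitz_on UNIV G)"

text \<open>
  The stacked variable \<open>(x\<^sub>1, \<dots>, x\<^sub>N)\<close> is a vector of vectors, indexed by the finite type
  \<open>'N\<close>. Its inner product is the sum of the inner products of the blocks, so its norm is the
  Euclidean norm.
\<close>

definition stacked_obj :: "('N::finite \<Rightarrow> real^'n::finite \<Rightarrow> real) \<Rightarrow> (real^'n)^'N \<Rightarrow> real" where
  "stacked_obj f x = (\<Sum>i\<in>UNIV. f i (x $ i))"

definition consensus_optimal ::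
    "('N::finite \<Rightarrow> real^'n::finite \<Rightarrow> real) \<Rightarrow> (real^'n)^'N \<Rightarrow> real^'n \<Rightarrow> bool" where
  "consensus_optimal f x z \<longleftrightarrow>
     is_arg_min (\<lambda>(x, z). stacked_obj f x) (\<lambda>(x, z). \<forall>i. x $ i = z) (x, z)"

text \<open>
  Multipliers of the constraints \<open>x\<^sub>i = z\<close>: the gradient of the Lagrangian
  \<open>\<Sum>\<^sub>i f\<^sub>i(x\<^sub>i) + \<lambda>\<^sub>i \<bullet> (x\<^sub>i - z)\<close> in \<open>(x, z)\<close> vanishes at \<open>x\<^sub>i = z\<close>.
\<close>

definition optimal_dual ::
    "('N::finite \<Rightarrow> real^'n::finite \<Rightarrow> real) \<Rightarrow> real^'n \<Rightarrow> (real^'n)^'N \<Rightarrow> bool" where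
  "optimal_dual f z lam \<longleftrightarrow>
     (\<forall>i. \<exists>g. GDERIV (f i) z :> g \<and> g + lam $ i = 0) \<and> (\<Sum>i\<in>UNIV. lam $ i) = 0"

type_synonym ('n, 'N) state = "(real^'n) \<times> ((real^'n)^'N)"

text \<open>
  The choice made by \<open>arg_min\<close> is immaterial here: for convex differentiable \<open>f\<^sub>i\<close> and
  \<open>\<rho> > 0\<close> the minimiser exists and is unique.
\<close>

definition aladin_x ::
    "('N::finite \<Rightarrow> real^'n::finite \<Rightarrow> real) \<Rightarrow> real \<Rightarrow> ('n, 'N) state \<Rightarrow> (real^'n)^'N" where
  "aladin_x f \<rho> = (\<lambda>(z, lam). \<chi> i.
     arg_min (\<lambda>y. f i y + lam $ i \<bullet> y + \<rho> / 2 * (norm (y - z))\<^sup>2) (\<lambda>_. True))"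

definition aladin_g ::
    "('N::finite \<Rightarrow> real^'n::finite \<Rightarrow> real) \<Rightarrow> real \<Rightarrow> ('n, 'N) state \<Rightarrow> (real^'n)^'N" where
  "aladin_g f \<rho> = (\<lambda>(z, lam). \<chi> i. \<rho> *\<^sub>R (z - aladin_x f \<rho> (z, lam) $ i) - lam $ i)"

definition aladin_z ::
    "('N::finite \<Rightarrow> real^'n::finite \<Rightarrow> real) \<Rightarrow> real \<Rightarrow> ('n, 'N) state \<Rightarrow> real^'n" where
  "aladin_z f \<rho> s = (1 / real CARD('N)) *\<^sub>R
     (\<Sum>i\<in>UNIV. aladin_x f \<rho> s $ i - (1 / \<rho>) *\<^sub>R (aladin_g f \<rho> s $ i))"

definition aladin_dual ::
    "('N::finite \<Rightarrow> real^'n::finite \<Rightarrow> real) \<Rightarrow> real \<Rightarrow> ('n, 'N) state \<Rightarrow> (real^'n)^'N" where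
  "aladin_dual f \<rho> s =
     (\<chi> i. \<rho> *\<^sub>R (aladin_x f \<rho> s $ i - aladin_z f \<rho> s) - aladin_g f \<rho> s $ i)"

definition aladin_step ::
    "('N::finite \<Rightarrow> real^'n::finite \<Rightarrow> real) \<Rightarrow> real
      \<Rightarrow> ('n, 'N) state \<Rightarrow> ('n, 'N) state" where
  "aladin_step f \<rho> s = (aladin_z f \<rho> s, aladin_dual f \<rho> s)"

definition lyapunov ::
    "real \<Rightarrow> ('n::finite, 'N::finite) state \<Rightarrow> ('n, 'N) state \<Rightarrow> real" where
  "lyapunov \<rho> = (\<lambda>(zs, lams) (z, lam).
     1 / \<rho> * (\<Sum>i\<in>UNIV. (norm (lam $ i - lams $ i))\<^sup>2)
       + \<rho> * real CARD('N) * (norm (z - zs))\<^sup>2)"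

text \<open>
  Q-linear convergence with rate \<open>r\<close>, measured in a distance \<open>d\<close>.
  It is instantiated with the distance \<open>\<lambda>s t. sqrt (lyapunov \<rho> t s)\<close>, which comes from a
  weighted Euclidean norm on the pairs \<open>(z, \<lambda>)\<close>.
\<close>

definition converges_Q_linearly ::
    "('a::topological_space \<Rightarrow> 'a \<Rightarrow> real) \<Rightarrow> (nat \<Rightarrow> 'a) \<Rightarrow> 'a \<Rightarrow> real \<Rightarrow> bool" where
  "converges_Q_linearly d X l r \<longleftrightarrow>
     0 < r \<and> r < 1 \<and> X \<longlonglongrightarrow> l \<and> (\<forall>k. d (X (Suc k)) l \<le> r * d (X k) l)"

end

theory Submission
  imports Defs
begin

text \<open>
  Write \<open>F\<close> for the stacked objective and \<open>G\<close> for its gradient, and think of \<open>z\<close> and \<open>z\<^sup>*\<close> also as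
  stacked vectors with all blocks equal. The first-order condition of the proximal problems says
  that \<open>g\<close> is \<open>G x\<^sup>+\<close>, and therefore \<open>\<rho> z - \<lambda> = \<rho> x\<^sup>+ + g\<close>, while the updates of \<open>z\<close> and \<open>\<lambda>\<close> give
  \<open>\<rho> z\<^sup>+ + \<lambda>\<^sup>+ = \<rho> x\<^sup>+ - g\<close>. Dual vectors whose blocks sum to zero are orthogonal to constant
  stacked vectors, so \<open>\<rho> L(z, \<lambda>)\<close> is the squared norm of \<open>\<rho> (z - z\<^sup>*) + (\<lambda> - \<lambda>\<^sup>*)\<close> as well as of
  \<open>\<rho> (z - z\<^sup>*) - (\<lambda> - \<lambda>\<^sup>*)\<close>. With \<open>\<lambda>\<^sup>* = - g\<^sup>*\<close> the polarisation identity yields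
  \<open>L(z, \<lambda>) - L(z\<^sup>+, \<lambda>\<^sup>+) = 4 (g - g\<^sup>*) \<bullet> (x\<^sup>+ - z\<^sup>*)\<close>, which is \<open>lyapunov_aladin_step\<close>.

  The gradient of a convex \<open>\<omega>\<close>-smooth function is cocoercive (\<open>gradient_cocoercive\<close>), so the right
  side is at least \<open>4 / \<omega> \<parallel>g - g\<^sup>*\<parallel>\<^sup>2\<close>, and hence at least \<open>\<delta> L(z\<^sup>+, \<lambda>\<^sup>+)\<close> by hypothesis. Thus
  \<open>(1 + \<delta>) L(z\<^sup>+, \<lambda>\<^sup>+) \<le> L(z, \<lambda>)\<close>, and the rate is the one claimed because the distance is the
  square root of \<open>L\<close>.

  The contraction also gives uniqueness: if \<open>z\<close> is optimal, then \<open>(z, - G z)\<close> is a fixed point of the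
  iteration (\<open>aladin_step_fixed_point\<close>), so \<open>L\<close> vanishes there. The multipliers are unique because
  they are the negative gradients at \<open>z\<^sup>*\<close>.
\<close>

section \<open>Smooth convex functions\<close>

lemma GDERIV_along_line:
  assumes "\<And>x. GDERIV F x :> G x"
  shows "((\<lambda>t. F (x + t *\<^sub>R h)) has_real_derivative (h \<bullet> G (x + t *\<^sub>R h))) (at t)"
proof -
  have "(F has_derivative (\<lambda>k. k \<bullet> G (x + t *\<^sub>R h))) (at (x + t *\<^sub>R h))"
    using assms by (simp add: gderiv_def)
  moreover have "((\<lambda>t. x + t *\<^sub>R h) has_derivative (\<lambda>s. s *\<^sub>R h)) (at t)"
    by (auto intro!: derivative_eq_intros)
  ultimately have "((\<lambda>t. F (x + t *\<^sub>R h)) has_derivative (\<lambda>s. (s *\<^sub>R h) \<bullet> G (x + t *\<^sub>R h))) (at t)"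
    using has_derivative_compose by blast
  then show ?thesis
    by (simp add: has_field_derivative_def mult_commute_abs)
qed

lemma convex_above_tangent_plane:
  fixes F :: "'a::real_inner \<Rightarrow> real"
  assumes "convex_on UNIV F" and grad: "\<And>x. GDERIV F x :> G x"
  shows "F x + G x \<bullet> (y - x) \<le> F y"
proof -
  let ?\<psi> = "\<lambda>t. F (x + t *\<^sub>R (y - x))"
  have "convex_on UNIV ?\<psi>"
  proof (rule convex_onI)
    fix t u v :: real
    assume "0 < t" "t < 1"
    have "x + ((1 - t) *\<^sub>R u + t *\<^sub>R v) *\<^sub>R (y - x)
        = (1 - t) *\<^sub>R (x + u *\<^sub>R (y - x)) + t *\<^sub>R (x + v *\<^sub>R (y - x))"
      by (simp add: algebra_simps)
    with convex_onD[OF assms(1), of t "x + u *\<^sub>R (y - x)" "x + v *\<^sub>R (y - x)"] \<open>0 < t\<close> \<open>t < 1\<close>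
    show "?\<psi> ((1 - t) *\<^sub>R u + t *\<^sub>R v) \<le> (1 - t) * ?\<psi> u + t * ?\<psi> v"
      by simp
  qed simp
  moreover have "(?\<psi> has_real_derivative ((y - x) \<bullet> G (x + 0 *\<^sub>R (y - x)))) (at 0 within UNIV)"
    by (rule GDERIV_along_line[OF grad])
  ultimately have "?\<psi> 1 - ?\<psi> 0 \<ge> ((y - x) \<bullet> G (x + 0 *\<^sub>R (y - x))) * (1 - 0)"
    by (intro convex_on_imp_above_tangent[where A = UNIV]) auto
  then show ?thesis
    by (simp add: inner_commute)
qed

text \<open>
  Subtracting the quadratic \<open>\<omega> / 2 t\<^sup>2 \<parallel>h\<parallel>\<^sup>2\<close> leaves a nonincreasing function along the
  segment, because the Lipschitz bound makes its derivative nonpositive.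
\<close>

lemma smooth_below_quadratic:
  fixes F :: "'a::real_inner \<Rightarrow> real"
  assumes grad: "\<And>x. GDERIV F x :> G x" and lip: "\<omega>-lipschitz_on UNIV G"
  shows "F (x + h) \<le> F x + G x \<bullet> h + \<omega> / 2 * (norm h)\<^sup>2"
proof -
  let ?\<phi> = "\<lambda>t. F (x + t *\<^sub>R h) - t * (h \<bullet> G x) - \<omega> / 2 * t\<^sup>2 * (norm h)\<^sup>2"
  have "?\<phi> 1 \<le> ?\<phi> 0"
  proof (rule DERIV_nonpos_imp_nonincreasing[of 0 1 ?\<phi>])
    fix t :: real
    assume "0 \<le> t" "t \<le> 1"
    have "h \<bullet> (G (x + t *\<^sub>R h) - G x) \<le> norm h * norm (G (x + t *\<^sub>R h) - G x)"
      by (rule norm_cauchy_schwarz)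
    also have "\<dots> \<le> norm h * (\<omega> * (t * norm h))"
      using lipschitz_onD[OF lip, of "x + t *\<^sub>R h" x] \<open>0 \<le> t\<close>
      by (intro mult_left_mono) (auto simp: dist_norm)
    finally have "h \<bullet> G (x + t *\<^sub>R h) - h \<bullet> G x - \<omega> * t * (norm h)\<^sup>2 \<le> 0"
      by (simp add: inner_diff_right power2_eq_square mult_ac)
    moreover have "(?\<phi> has_real_derivative
        (h \<bullet> G (x + t *\<^sub>R h) - h \<bullet> G x - \<omega> * t * (norm h)\<^sup>2)) (at t)"
      by (auto intro!: derivative_eq_intros GDERIV_along_line[OF grad])
    ultimately show "\<exists>y. (?\<phi> has_real_derivative y) (at t) \<and> y \<le> 0"
      by blast
  qed simp
  then show ?thesis
    by (simp add: inner_commute)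
qed

text \<open>
  A gradient step of length \<open>1 / \<omega>\<close> from \<open>y\<close> on the Bregman distance
  \<open>F - F x - G x \<bullet> (\<cdot> - x)\<close>, which is nonnegative, lowers it by
  \<open>\<parallel>G y - G x\<parallel>\<^sup>2 / (2 \<omega>)\<close>.
\<close>

lemma bregman_distance_ge:
  fixes F :: "'a::real_inner \<Rightarrow> real"
  assumes grad: "\<And>x. GDERIV F x :> G x" and lip: "\<omega>-lipschitz_on UNIV G"
    and conv: "convex_on UNIV F" and "\<omega> > 0"
  shows "(norm (G y - G x))\<^sup>2 / (2 * \<omega>) \<le> F y - F x - G x \<bullet> (y - x)"
proof -
  define d where "d = G y - G x"
  define h where "h = - ((1 / \<omega>) *\<^sub>R d)"
  have "F x + G x \<bullet> (y + h - x) \<le> F (y + h)"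
    by (rule convex_above_tangent_plane[OF conv grad])
  moreover have "F (y + h) \<le> F y + G y \<bullet> h + \<omega> / 2 * (norm h)\<^sup>2"
    by (rule smooth_below_quadratic[OF grad lip])
  moreover have "G x \<bullet> (y + h - x) = G x \<bullet> (y - x) + G x \<bullet> h"
    by (simp add: algebra_simps inner_add_right inner_diff_right)
  moreover have "G y \<bullet> h - G x \<bullet> h = - ((norm d)\<^sup>2 / \<omega>)"
  proof -
    have "G y \<bullet> h - G x \<bullet> h = d \<bullet> h"
      by (simp add: d_def inner_diff_left)
    then show ?thesis
      by (simp add: h_def power2_norm_eq_inner)
  qed
  moreover have "\<omega> / 2 * (norm h)\<^sup>2 = (norm d)\<^sup>2 / (2 * \<omega>)"
    using \<open>\<omega> > 0\<close> by (simp add: h_def power_mult_distrib power2_eq_square)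
  moreover have "(norm d)\<^sup>2 / \<omega> = 2 * ((norm d)\<^sup>2 / (2 * \<omega>))"
    by simp
  ultimately show ?thesis
    unfolding d_def by linarith
qed

text \<open>
  This is the theorem of Baillon and Haddad: the bound on the Bregman distance, added to itself
  with \<open>x\<close> and \<open>y\<close> exchanged.
\<close>

lemma gradient_cocoercive:
  fixes F :: "'a::real_inner \<Rightarrow> real"
  assumes "\<And>x. GDERIV F x :> G x" and "\<omega>-lipschitz_on UNIV G"
    and "convex_on UNIV F" and "\<omega> > 0"
  shows "(norm (G x - G y))\<^sup>2 / \<omega> \<le> (G x - G y) \<bullet> (x - y)"
proof -
  have "(norm (G x - G y))\<^sup>2 / \<omega>
      = (norm (G y - G x))\<^sup>2 / (2 * \<omega>) + (norm (G x - G y))\<^sup>2 / (2 * \<omega>)"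
    by (simp add: norm_minus_commute)
  also have "\<dots> \<le> (F y - F x - G x \<bullet> (y - x)) + (F x - F y - G y \<bullet> (x - y))"
    by (intro add_mono bregman_distance_ge assms)
  also have "\<dots> = (G x - G y) \<bullet> (x - y)"
    by (simp add: algebra_simps)
  finally show ?thesis .
qed

lemma GDERIV_unique:
  assumes "GDERIV F x :> a" and "GDERIV F x :> b"
  shows "a = b"
proof -
  have "(\<lambda>h. h \<bullet> a) = (\<lambda>h. h \<bullet> b)"
    using assms has_derivative_unique unfolding gderiv_def by blast
  then have "\<forall>h. h \<bullet> a = h \<bullet> b"
    by (simp add: fun_eq_iff)
  then show ?thesis
    by (simp add: vector_eq_ldot)
qed

lemma GDERIV_zero_at_minimum:
  assumes "GDERIV F x :> a" and "\<And>y. F x \<le> F y"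
  shows "a = 0"
proof -
  have "(\<lambda>h. h \<bullet> a) = (\<lambda>h. 0)"
    using assms by (intro has_derivative_local_min[of F]) (auto simp: gderiv_def)
  then have "a \<bullet> a = 0"
    by meson
  then show ?thesis
    by simp
qed

section \<open>Proximal problems\<close>

definition prox_obj :: "('a::real_inner \<Rightarrow> real) \<Rightarrow> real \<Rightarrow> 'a \<Rightarrow> 'a \<Rightarrow> 'a \<Rightarrow> real" where
  "prox_obj F \<rho> z lam y = F y + lam \<bullet> y + \<rho> / 2 * (norm (y - z))\<^sup>2"

lemma GDERIV_prox_obj:
  assumes "GDERIV F y :> g"
  shows "GDERIV (prox_obj F \<rho> z lam) y :> g + lam + \<rho> *\<^sub>R (y - z)"
  using assms unfolding prox_obj_def[abs_def] gderiv_def power2_norm_eq_inner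
  by (auto intro!: derivative_eq_intros simp: algebra_simps inner_commute)

text \<open>
  The tangent plane of \<open>F\<close> at \<open>z\<close> bounds the objective below by a quadratic, which shows that
  outside some ball around \<open>z\<close> it is at least its value at \<open>z\<close>. A minimiser over that ball, which
  exists by compactness, is therefore a global one.
\<close>

lemma prox_obj_attains_min:
  fixes F :: "'a::euclidean_space \<Rightarrow> real"
  assumes grad: "\<And>x. GDERIV F x :> G x" and conv: "convex_on UNIV F" and "\<rho> > 0"
  obtains x where "\<And>y. prox_obj F \<rho> z lam x \<le> prox_obj F \<rho> z lam y"
proof -
  let ?P = "prox_obj F \<rho> z lam"
  define R where "R = 2 * norm (G z + lam) / \<rho>"
  have "isCont ?P y" for y
    using GDERIV_prox_obj[OF grad] unfolding gderiv_def by (rule has_derivative_continuous)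
  then have "continuous_on (cball z R) ?P"
    by (simp add: continuous_at_imp_continuous_on)
  moreover have "R \<ge> 0"
    using \<open>\<rho> > 0\<close> by (simp add: R_def)
  ultimately obtain x where x: "\<And>y. y \<in> cball z R \<Longrightarrow> ?P x \<le> ?P y"
    using continuous_attains_inf[of "cball z R" ?P] compact_cball
    by (metis cball_eq_empty not_less)
  have outside: "?P z \<le> ?P y" if "y \<notin> cball z R" for y
  proof -
    have "norm (G z + lam) \<le> \<rho> / 2 * norm (y - z)"
      using that \<open>\<rho> > 0\<close> by (simp add: R_def dist_norm norm_minus_commute field_simps)
    then have "norm (G z + lam) * norm (y - z) \<le> \<rho> / 2 * norm (y - z) * norm (y - z)"
      by (rule mult_right_mono) simp
    moreover have "- ((G z + lam) \<bullet> (y - z)) \<le> norm (G z + lam) * norm (y - z)"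
      using norm_cauchy_schwarz[of "- (G z + lam)" "y - z"]
      by (simp only: norm_minus_cancel inner_minus_left)
    moreover have "F z + G z \<bullet> (y - z) \<le> F y"
      by (rule convex_above_tangent_plane[OF conv grad])
    moreover have "(G z + lam) \<bullet> (y - z) = G z \<bullet> (y - z) + lam \<bullet> y - lam \<bullet> z"
      by (simp add: algebra_simps)
    ultimately show ?thesis
      by (simp add: prox_obj_def power2_eq_square)
  qed
  have "?P x \<le> ?P y" for y
    using x[of y] x[of z] outside[of y] \<open>R \<ge> 0\<close> by (cases "y \<in> cball z R") auto
  then show thesis
    by (rule that)
qed

section \<open>Stacked vectors\<close>

lemma power2_norm_vec:
  fixes x :: "('a::real_inner)^'N::finite"
  shows "(norm x)\<^sup>2 = (\<Sum>i\<in>UNIV. (norm (x $ i))\<^sup>2)"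
  by (simp add: power2_norm_eq_inner inner_vec_def)

lemma inner_const_vec:
  fixes x :: "('a::real_inner)^'N::finite"
  shows "x \<bullet> (\<chi> i. c) = (\<Sum>i\<in>UNIV. x $ i) \<bullet> c"
  by (simp add: inner_vec_def inner_sum_left)

lemma GDERIV_stacked_obj:
  fixes f :: "'N::finite \<Rightarrow> real^'n::finite \<Rightarrow> real"
  assumes "\<And>i. GDERIV (f i) (x $ i) :> g $ i"
  shows "GDERIV (stacked_obj f) x :> g"
proof -
  have "((\<lambda>x. f i (x $ i)) has_derivative (\<lambda>h. h $ i \<bullet> g $ i)) (at x)" for i
    using assms[of i] unfolding gderiv_def
    by (rule has_derivative_compose[OF bounded_linear_imp_has_derivative[OF bounded_linear_vec_nth]])
  then have "((\<lambda>x. \<Sum>i\<in>UNIV. f i (x $ i)) has_derivative (\<lambda>h. \<Sum>i\<in>UNIV. h $ i \<bullet> g $ i)) (at x)"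
    by (intro has_derivative_sum)
  then show ?thesis
    by (simp add: gderiv_def stacked_obj_def[abs_def] inner_vec_def)
qed

lemma prox_obj_stacked:
  "prox_obj (stacked_obj f) \<rho> z lam x = (\<Sum>i\<in>UNIV. prox_obj (f i) \<rho> (z $ i) (lam $ i) (x $ i))"
  by (simp add: prox_obj_def stacked_obj_def power2_norm_vec inner_vec_def sum.distrib
      sum_distrib_left)

text \<open>
  A minimiser of the stacked objective minimises each block, since the blocks can be varied
  one at a time; this is what gives the choice by \<open>arg_min\<close> in each block its meaning.
\<close>

lemma aladin_x_minimises:
  fixes f :: "'N::finite \<Rightarrow> real^'n::finite \<Rightarrow> real"
  assumes "\<And>x. GDERIV (stacked_obj f) x :> G x" and "convex_on UNIV (stacked_obj f)" and "\<rho> > 0"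
  shows "prox_obj (stacked_obj f) \<rho> (\<chi> i. z) lam (aladin_x f \<rho> (z, lam))
    \<le> prox_obj (stacked_obj f) \<rho> (\<chi> i. z) lam y"
proof -
  let ?P = "prox_obj (stacked_obj f) \<rho> (\<chi> i. z) lam"
  let ?p = "\<lambda>i. prox_obj (f i) \<rho> z (lam $ i)"
  obtain x where x: "\<And>y. ?P x \<le> ?P y"
    using prox_obj_attains_min[OF assms] by blast
  have block: "?p i (x $ i) \<le> ?p i u" for i u
  proof -
    let ?y = "\<chi> j. if j = i then u else x $ j"
    have "(\<Sum>j\<in>UNIV. ?p j (?y $ j)) = ?p i u + (\<Sum>j\<in>UNIV - {i}. ?p j (x $ j))"
      by (subst sum.remove[of _ i]) auto
    moreover have "(\<Sum>j\<in>UNIV. ?p j (x $ j)) = ?p i (x $ i) + (\<Sum>j\<in>UNIV - {i}. ?p j (x $ j))"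
      by (subst sum.remove[of _ i]) auto
    ultimately show ?thesis
      using x[of ?y] by (simp add: prox_obj_stacked)
  qed
  have "is_arg_min (?p i) (\<lambda>_. True) (aladin_x f \<rho> (z, lam) $ i)" for i
  proof -
    have "is_arg_min (?p i) (\<lambda>_. True) (arg_min (?p i) (\<lambda>_. True))"
      unfolding arg_min_def
      by (rule someI[of _ "x $ i"]) (simp add: is_arg_min_linorder block)
    then show ?thesis
      by (simp add: aladin_x_def prox_obj_def[abs_def])
  qed
  then show ?thesis
    by (simp add: prox_obj_stacked is_arg_min_linorder sum_mono)
qed

text \<open>
  The vector \<open>g\<close> of the algorithm is the one that the first-order condition of the proximal
  problem forces to be the gradient at the new point.
\<close>

lemma aladin_g_eq_gradient:
  fixes f :: "'N::finite \<Rightarrow> real^'n::finite \<Rightarrow> real"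
  assumes grad: "\<And>x. GDERIV (stacked_obj f) x :> G x" and "convex_on UNIV (stacked_obj f)"
    and "\<rho> > 0"
  shows "aladin_g f \<rho> s = G (aladin_x f \<rho> s)"
proof -
  obtain z lam where s: "s = (z, lam)"
    by (cases s)
  have "G (aladin_x f \<rho> s) + lam + \<rho> *\<^sub>R (aladin_x f \<rho> s - (\<chi> i. z)) = 0"
    unfolding s
    by (rule GDERIV_zero_at_minimum[OF GDERIV_prox_obj[OF grad] aladin_x_minimises[OF assms]])
  then have "G (aladin_x f \<rho> s) = \<rho> *\<^sub>R ((\<chi> i. z) - aladin_x f \<rho> s) - lam"
    by (simp add: algebra_simps eq_neg_iff_add_eq_0)
  then show ?thesis
    by (simp add: vec_eq_iff aladin_g_def s)
qed

section \<open>One iteration\<close>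

lemma sum_aladin_dual:
  fixes f :: "'N::finite \<Rightarrow> real^'n::finite \<Rightarrow> real"
  assumes "\<rho> > 0"
  shows "(\<Sum>i\<in>UNIV. aladin_dual f \<rho> s $ i) = 0"
proof -
  have "\<rho> *\<^sub>R (real CARD('N) *\<^sub>R aladin_z f \<rho> s)
      = (\<Sum>i\<in>UNIV. \<rho> *\<^sub>R aladin_x f \<rho> s $ i - aladin_g f \<rho> s $ i)"
    using assms by (simp add: aladin_z_def scaleR_sum_right scaleR_diff_right)
  moreover have "aladin_dual f \<rho> s $ i
      = (\<rho> *\<^sub>R aladin_x f \<rho> s $ i - aladin_g f \<rho> s $ i) - \<rho> *\<^sub>R aladin_z f \<rho> s" for i
    by (simp add: aladin_dual_def scaleR_diff_right)
  ultimately show ?thesis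
    by (simp add: sum_subtractf sum_constant_scaleR mult.commute del: sum_constant)
qed

lemma lyapunov_eq:
  "lyapunov \<rho> (zs, lams) ((z, lam) :: ('n::finite, 'N::finite) state)
    = (norm (lam - lams))\<^sup>2 / \<rho> + \<rho> * real CARD('N) * (norm (z - zs))\<^sup>2"
  by (simp add: lyapunov_def power2_norm_vec)

lemma lyapunov_nonneg:
  "\<rho> > 0 \<Longrightarrow> 0 \<le> lyapunov \<rho> t s"
  by (cases t; cases s) (simp add: lyapunov_def sum_nonneg)

text \<open>
  Constant stacked vectors are orthogonal to those whose blocks sum to zero, so that the
  Lyapunov function does not see the sign with which the dual error is added to the primal one.
\<close>

lemma lyapunov_eq_norm_minus:
  fixes lam lams :: "(real^'n::finite)^'N::finite"
  assumes "\<rho> > 0" and "(\<Sum>i\<in>UNIV. lam $ i) = 0" and "(\<Sum>i\<in>UNIV. lams $ i) = 0"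
  shows "lyapunov \<rho> (zs, lams) (z, lam)
    = (norm (\<rho> *\<^sub>R (\<chi> i. z - zs) - (lam - lams)))\<^sup>2 / \<rho>"
proof -
  have orth: "(lam - lams) \<bullet> (\<chi> i. z - zs) = 0"
    using assms by (simp add: inner_const_vec sum_subtractf)
  have c: "(norm ((\<chi> i. z - zs) :: (real^'n)^'N))\<^sup>2 = real CARD('N) * (norm (z - zs))\<^sup>2"
    by (simp add: power2_norm_vec)
  have "(norm (\<rho> *\<^sub>R (\<chi> i. z - zs) - (lam - lams)))\<^sup>2
      = \<rho>\<^sup>2 * (norm ((\<chi> i. z - zs) :: (real^'n)^'N))\<^sup>2 + (norm (lam - lams))\<^sup>2"
    using orth unfolding power2_norm_eq_inner
    by (simp add: inner_diff_left inner_diff_right inner_commute power2_eq_square mult.assoc)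
  then show ?thesis
    using assms(1) unfolding c
    by (simp add: lyapunov_eq add_divide_distrib power2_eq_square)
qed

lemma lyapunov_eq_norm_plus:
  fixes lam lams :: "(real^'n::finite)^'N::finite"
  assumes "\<rho> > 0" and "(\<Sum>i\<in>UNIV. lam $ i) = 0" and "(\<Sum>i\<in>UNIV. lams $ i) = 0"
  shows "lyapunov \<rho> (zs, lams) (z, lam)
    = (norm (\<rho> *\<^sub>R (\<chi> i. z - zs) + (lam - lams)))\<^sup>2 / \<rho>"
proof -
  have "lyapunov \<rho> (zs, lams) (z, lam) = lyapunov \<rho> (zs, - lams) (z, - lam)"
    by (simp add: lyapunov_def norm_minus_commute)
  also have "\<dots> = (norm (\<rho> *\<^sub>R (\<chi> i. z - zs) - (- lam - - lams)))\<^sup>2 / \<rho>"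
    using assms by (intro lyapunov_eq_norm_minus) (auto simp: sum_negf)
  also have "- lam - - lams = - (lam - lams)"
    by simp
  finally show ?thesis
    by (simp only: diff_minus_eq_add)
qed

text \<open>
  By their definitions, \<open>\<rho> z - \<lambda> = \<rho> x\<^sup>+ + g\<close> before the step and \<open>\<rho> z\<^sup>+ + \<lambda>\<^sup>+ = \<rho> x\<^sup>+ - g\<close> after it,
  so that the two values of the Lyapunov function are squared norms of a sum and of a difference.
\<close>

lemma lyapunov_aladin_step:
  fixes f :: "'N::finite \<Rightarrow> real^'n::finite \<Rightarrow> real"
  assumes "\<rho> > 0" and lam: "(\<Sum>i\<in>UNIV. lam $ i) = 0" and gs: "(\<Sum>i\<in>UNIV. gs $ i) = 0"
  shows "lyapunov \<rho> (zs, - gs) (z, lam) - lyapunov \<rho> (zs, - gs) (aladin_step f \<rho> (z, lam))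
    = 4 * ((aladin_g f \<rho> (z, lam) - gs) \<bullet> (aladin_x f \<rho> (z, lam) - (\<chi> i. zs)))"
proof -
  define a where "a = aladin_x f \<rho> (z, lam) - (\<chi> i. zs)"
  define b where "b = aladin_g f \<rho> (z, lam) - gs"
  have before: "\<rho> *\<^sub>R (\<chi> i. z - zs) - (lam - - gs) = \<rho> *\<^sub>R a + b"
    by (simp add: vec_eq_iff a_def b_def aladin_g_def algebra_simps)
  have after: "\<rho> *\<^sub>R (\<chi> i. aladin_z f \<rho> (z, lam) - zs) + (aladin_dual f \<rho> (z, lam) - - gs)
      = \<rho> *\<^sub>R a - b"
    by (simp add: vec_eq_iff a_def b_def aladin_dual_def algebra_simps)
  have gs': "(\<Sum>i\<in>UNIV. (- gs) $ i) = 0"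
    using gs by (simp add: sum_negf)
  have "lyapunov \<rho> (zs, - gs) (z, lam) = (norm (\<rho> *\<^sub>R a + b))\<^sup>2 / \<rho>"
    using lyapunov_eq_norm_minus[OF \<open>\<rho> > 0\<close> lam gs'] by (simp only: before)
  moreover have "lyapunov \<rho> (zs, - gs) (aladin_step f \<rho> (z, lam)) = (norm (\<rho> *\<^sub>R a - b))\<^sup>2 / \<rho>"
    unfolding aladin_step_def
    using lyapunov_eq_norm_plus[OF \<open>\<rho> > 0\<close> sum_aladin_dual[OF \<open>\<rho> > 0\<close>] gs'] by (simp only: after)
  moreover have "(norm (\<rho> *\<^sub>R a + b))\<^sup>2 - (norm (\<rho> *\<^sub>R a - b))\<^sup>2 = 4 * \<rho> * (b \<bullet> a)"
    unfolding power2_norm_eq_inner by (simp add: algebra_simps inner_commute)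
  ultimately show ?thesis
    using \<open>\<rho> > 0\<close> unfolding a_def[symmetric] b_def[symmetric]
    by (simp flip: diff_divide_distrib)
qed

text \<open>
  Started from the multiplier \<open>- G z\<close>, the first-order condition for the new point reads
  \<open>G x\<^sup>+ - G z = - \<rho> (x\<^sup>+ - z)\<close>, which monotonicity of the gradient allows only for \<open>x\<^sup>+ = z\<close>.
  Then \<open>g = G z\<close>, whose average vanishes, so that the averaging step returns \<open>z\<close> as well.
\<close>

lemma aladin_step_fixed_point:
  fixes f :: "'N::finite \<Rightarrow> real^'n::finite \<Rightarrow> real"
  assumes grad: "\<And>x. GDERIV (stacked_obj f) x :> G x" and lip: "\<omega>-lipschitz_on UNIV G"
    and conv: "convex_on UNIV (stacked_obj f)" and "\<omega> > 0" and "\<rho> > 0"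
    and zero: "(\<Sum>i\<in>UNIV. G (\<chi> i. z) $ i) = 0"
  shows "aladin_step f \<rho> (z, - G (\<chi> i. z)) = (z, - G (\<chi> i. z))"
proof -
  let ?Z = "(\<chi> i. z) :: (real^'n)^'N"
  let ?s = "(z, - G ?Z)"
  let ?x = "aladin_x f \<rho> ?s"
  have g: "aladin_g f \<rho> ?s = G ?x"
    by (rule aladin_g_eq_gradient[OF grad conv \<open>\<rho> > 0\<close>])
  moreover have "aladin_g f \<rho> ?s = \<rho> *\<^sub>R (?Z - ?x) + G ?Z"
    by (simp add: vec_eq_iff aladin_g_def)
  ultimately have "G ?x - G ?Z = - (\<rho> *\<^sub>R (?x - ?Z))"
    by (simp add: algebra_simps)
  then have "(G ?x - G ?Z) \<bullet> (?x - ?Z) = - (\<rho> * (norm (?x - ?Z))\<^sup>2)"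
    by (simp only: inner_minus_left inner_scaleR_left power2_norm_eq_inner)
  moreover have "0 \<le> (norm (G ?x - G ?Z))\<^sup>2 / \<omega>"
    using \<open>\<omega> > 0\<close> by simp
  ultimately have "\<rho> * (norm (?x - ?Z))\<^sup>2 \<le> 0"
    using gradient_cocoercive[OF grad lip conv \<open>\<omega> > 0\<close>, of ?x ?Z] by linarith
  then have x: "?x = ?Z"
    using \<open>\<rho> > 0\<close> by (simp add: mult_le_0_iff)
  have z: "aladin_z f \<rho> ?s = z"
    using zero by (simp add: aladin_z_def g x sum_subtractf sum_constant_scaleR
        del: sum_constant flip: scaleR_sum_right)
  show ?thesis
    by (simp add: aladin_step_def z aladin_dual_def g x vec_eq_iff)
qed

section \<open>Optimality and convergence\<close>

text \<open>
  The block sum of \<open>G\<close> is the gradient of the objective restricted to the diagonal.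
\<close>

lemma consensus_optimal_gradient_sum:
  fixes f :: "'N::finite \<Rightarrow> real^'n::finite \<Rightarrow> real"
  assumes "consensus_optimal f x z" and grad: "\<And>x. GDERIV (stacked_obj f) x :> G x"
  shows "x = (\<chi> i. z)" and "(\<Sum>i\<in>UNIV. G (\<chi> i. z) $ i) = 0"
proof -
  have x: "\<forall>i. x $ i = z"
    and min: "\<And>y w. \<forall>i. y $ i = w \<Longrightarrow> stacked_obj f x \<le> stacked_obj f y"
    using assms(1) unfolding consensus_optimal_def is_arg_min_linorder by auto
  show eq: "x = (\<chi> i. z)"
    using x by (simp add: vec_eq_iff)
  have "((\<lambda>w. \<chi> i. w) has_derivative (\<lambda>h. (\<chi> i. h) :: (real^'n)^'N)) (at z)"
    by (intro bounded_linear_imp_has_derivative)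
      (auto simp: vec_eq_iff intro!: linearI simp flip: linear_conv_bounded_linear)
  then have "((\<lambda>w. stacked_obj f (\<chi> i. w)) has_derivative (\<lambda>h. (\<chi> i. h) \<bullet> G (\<chi> i. z))) (at z)"
    using has_derivative_compose grad unfolding gderiv_def by blast
  then have "GDERIV (\<lambda>w. stacked_obj f (\<chi> i. w)) z :> (\<Sum>i\<in>UNIV. G (\<chi> i. z) $ i)"
    unfolding gderiv_def by (metis (no_types, lifting) ext inner_commute inner_const_vec)
  then show "(\<Sum>i\<in>UNIV. G (\<chi> i. z) $ i) = 0"
    by (rule GDERIV_zero_at_minimum) (use min eq in auto)
qed

lemma lyapunov_tendsto_0_imp_tendsto:
  fixes X :: "nat \<Rightarrow> ('n::finite, 'N::finite) state"
  assumes "\<rho> > 0" and lim: "(\<lambda>k. lyapunov \<rho> (zs, lams) (X k)) \<longlonglongrightarrow> 0"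
  shows "X \<longlonglongrightarrow> (zs, lams)"
proof -
  let ?L = "\<lambda>k. lyapunov \<rho> (zs, lams) (X k)"
  have L: "?L k = (norm (snd (X k) - lams))\<^sup>2 / \<rho>
      + \<rho> * real CARD('N) * (norm (fst (X k) - zs))\<^sup>2" for k
    by (metis lyapunov_eq prod.collapse)
  have sqrt0: "(\<lambda>k. sqrt (c * ?L k)) \<longlonglongrightarrow> 0" for c
    using tendsto_real_sqrt[OF tendsto_mult_right_zero[OF lim, of c]] by simp
  have "norm (snd (X k) - lams) \<le> sqrt (\<rho> * ?L k)" for k
    using \<open>\<rho> > 0\<close> by (intro real_le_rsqrt) (simp add: L distrib_left)
  then have "(\<lambda>k. snd (X k) - lams) \<longlonglongrightarrow> 0"
    by (intro Lim_null_comparison[OF _ sqrt0[of \<rho>]]) auto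
  moreover have "norm (fst (X k) - zs) \<le> sqrt (1 / (\<rho> * real CARD('N)) * ?L k)" for k
    using \<open>\<rho> > 0\<close> by (intro real_le_rsqrt) (simp add: L distrib_left)
  then have "(\<lambda>k. fst (X k) - zs) \<longlonglongrightarrow> 0"
    by (intro Lim_null_comparison[OF _ sqrt0[of "1 / (\<rho> * real CARD('N))"]]) auto
  ultimately have "(\<lambda>k. (fst (X k), snd (X k))) \<longlonglongrightarrow> (zs, lams)"
    by (intro tendsto_Pair) (simp_all add: LIM_zero_iff)
  then show ?thesis
    by simp
qed

theorem corollary1:
  fixes f :: "'N::finite \<Rightarrow> real^'n::finite \<Rightarrow> real"
    and \<rho> \<omega> \<delta> :: real
    and zs :: "real^'n"
    and lams gs :: "(real^'n)^'N"
  assumes "\<rho> > 0" and "\<omega> > 0"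
    and smooth: "smooth_fun \<omega> (stacked_obj f)"
    and convex: "convex_on UNIV (stacked_obj f)"
    and opt: "consensus_optimal f (\<chi> i. zs) zs"
    and dual: "optimal_dual f zs lams"
    and grad: "\<And>i. GDERIV (f i) zs :> gs $ i"
    and "\<delta> > 0"
    and decrease: "\<And>z lam. (\<Sum>i\<in>UNIV. lam $ i) = 0 \<Longrightarrow>
          \<delta> * lyapunov \<rho> (zs, lams) (aladin_step f \<rho> (z, lam))
            \<le> 4 / \<omega> * (\<Sum>i\<in>UNIV. (norm (aladin_g f \<rho> (z, lam) $ i - gs $ i))\<^sup>2)"
  shows "(\<forall>x z. consensus_optimal f x z \<longrightarrow> x = (\<chi> i. zs) \<and> z = zs) \<and>
         (\<forall>lam. optimal_dual f zs lam \<longrightarrow> lam = lams) \<and>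
         (\<forall>z0 lam0. (\<Sum>i\<in>UNIV. lam0 $ i) = 0 \<longrightarrow>
            converges_Q_linearly (\<lambda>s t. sqrt (lyapunov \<rho> t s))
              (\<lambda>k. (aladin_step f \<rho> ^^ k) (z0, lam0)) (zs, lams) (1 / sqrt (1 + \<delta>)))"
proof -
  let ?L = "lyapunov \<rho> (zs, lams)"
  let ?step = "aladin_step f \<rho>"
  obtain G where G: "\<And>x. GDERIV (stacked_obj f) x :> G x" and lip: "\<omega>-lipschitz_on UNIV G"
    using smooth unfolding smooth_fun_def by blast
  have gs: "gs = G (\<chi> i. zs)"
    by (rule GDERIV_unique[OF GDERIV_stacked_obj G]) (simp add: grad)
  have dual_eq: "lam = - gs" if "optimal_dual f zs lam" for lam
  proof -
    have "lam $ i = - (gs $ i)" for i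
    proof -
      obtain g where "GDERIV (f i) zs :> g" and "g + lam $ i = 0"
        using \<open>optimal_dual f zs lam\<close> unfolding optimal_dual_def by blast
      then show ?thesis
        using GDERIV_unique[OF grad] by (metis add_eq_0_iff)
    qed
    then show ?thesis
      by (simp add: vec_eq_iff)
  qed
  have lams: "lams = - gs" and sum_gs: "(\<Sum>i\<in>UNIV. gs $ i) = 0"
    using dual_eq[OF dual] dual by (auto simp: optimal_dual_def sum_negf)

  have contract: "(1 + \<delta>) * ?L (?step (z, lam)) \<le> ?L (z, lam)"
    if "(\<Sum>i\<in>UNIV. lam $ i) = 0" for z lam
  proof -
    let ?x = "aladin_x f \<rho> (z, lam)" and ?g = "aladin_g f \<rho> (z, lam)"
    have "\<delta> * ?L (?step (z, lam)) \<le> 4 * ((norm (?g - gs))\<^sup>2 / \<omega>)"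
      using decrease[OF that] by (simp add: power2_norm_vec)
    also have "\<dots> \<le> 4 * ((?g - gs) \<bullet> (?x - (\<chi> i. zs)))"
      unfolding gs aladin_g_eq_gradient[OF G convex \<open>\<rho> > 0\<close>]
      by (intro mult_left_mono gradient_cocoercive[OF G lip convex \<open>\<omega> > 0\<close>]) simp
    also have "\<dots> = ?L (z, lam) - ?L (?step (z, lam))"
      unfolding lams by (rule lyapunov_aladin_step[OF \<open>\<rho> > 0\<close> that sum_gs, symmetric])
    finally show ?thesis
      by (simp add: algebra_simps)
  qed

  have primal: "x = (\<chi> i. zs) \<and> z = zs" if "consensus_optimal f x z" for x z
  proof -
    let ?s = "(z, - G (\<chi> i. z))"
    note x = consensus_optimal_gradient_sum[OF that G]
    have "?step ?s = ?s"
      by (rule aladin_step_fixed_point[OF G lip convex \<open>\<omega> > 0\<close> \<open>\<rho> > 0\<close> x(2)])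
    moreover have "(1 + \<delta>) * ?L (?step ?s) \<le> ?L ?s"
      using x(2) by (intro contract) (simp add: sum_negf)
    ultimately have "\<delta> * ?L ?s \<le> 0"
      by (simp add: algebra_simps)
    then have "?L ?s \<le> 0"
      using \<open>\<delta> > 0\<close> by (simp add: mult_le_0_iff)
    moreover have "\<rho> * real CARD('N) * (norm (z - zs))\<^sup>2 \<le> ?L ?s"
      using \<open>\<rho> > 0\<close> by (simp add: lyapunov_def sum_nonneg)
    ultimately have "\<rho> * real CARD('N) * (norm (z - zs))\<^sup>2 \<le> 0"
      by linarith
    then have "z = zs"
      using \<open>\<rho> > 0\<close> by (simp add: mult_le_0_iff)
    with x(1) show ?thesis
      by simp
  qed

  have "converges_Q_linearly (\<lambda>s t. sqrt (lyapunov \<rho> t s))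
      (\<lambda>k. (?step ^^ k) (z0, lam0)) (zs, lams) (1 / sqrt (1 + \<delta>))"
    if "(\<Sum>i\<in>UNIV. lam0 $ i) = 0" for z0 lam0
  proof -
    define X where "X k = (?step ^^ k) (z0, lam0)" for k
    have sum_dual: "(\<Sum>i\<in>UNIV. snd (X k) $ i) = 0" for k
      using that
      by (cases k) (simp_all add: X_def aladin_step_def sum_aladin_dual[OF \<open>\<rho> > 0\<close>])
    have rate: "?L (X (Suc k)) \<le> ?L (X k) / (1 + \<delta>)" for k
      using contract[OF sum_dual[of k], of "fst (X k)"] \<open>\<delta> > 0\<close> by (simp add: X_def field_simps)
    have geometric: "?L (X k) \<le> ?L (X 0) * (1 / (1 + \<delta>)) ^ k" for k
    proof (induction k)
      case (Suc k)
      have "?L (X k) / (1 + \<delta>) \<le> ?L (X 0) * (1 / (1 + \<delta>)) ^ k / (1 + \<delta>)"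
        using Suc.IH \<open>\<delta> > 0\<close> by (intro divide_right_mono) auto
      with rate[of k] show ?case
        by simp
    qed simp
    have "(\<lambda>k. ?L (X 0) * (1 / (1 + \<delta>)) ^ k) \<longlonglongrightarrow> 0"
      using \<open>\<delta> > 0\<close> by (intro tendsto_mult_right_zero LIMSEQ_power_zero) simp
    then have "(\<lambda>k. ?L (X k)) \<longlonglongrightarrow> 0"
      by (rule Lim_null_comparison[rotated])
        (simp add: geometric lyapunov_nonneg[OF \<open>\<rho> > 0\<close>])
    then have "X \<longlonglongrightarrow> (zs, lams)"
      by (rule lyapunov_tendsto_0_imp_tendsto[OF \<open>\<rho> > 0\<close>])
    moreover have "sqrt (?L (X (Suc k))) \<le> 1 / sqrt (1 + \<delta>) * sqrt (?L (X k))" for k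
      using real_sqrt_le_mono[OF rate[of k]] by (simp add: real_sqrt_divide)
    ultimately show ?thesis
      using \<open>\<delta> > 0\<close> unfolding converges_Q_linearly_def X_def[symmetric] by simp
  qed
  with primal dual_eq lams show ?thesis
    by blast
qed

end
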